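(* Let $\{M_0(t)\}_{t\ge0}$ and $\{M(t)\}_{t\ge0}$ be independent generalized counting processes with positive rates $\mu_1,\dots,\mu_{k_0}$ and $\lambda_1,\dots,\lambda_k$, respectively, let $\hat M(t)=M(M_0(t))$, $\mu=\sum_{j_0=1}^{k_0}\mu_{j_0}$ and $\lambda=\sum_{j=1}^{k}\lambda_j$. For an integer $n\ge1$ let $T_n=\inf\{s>0:\hat M(s)=n\}$ be the first-passage time of $\hat M$ to state $n$ (with $\inf\emptyset=\infty$). Then, for $s>0$, $$\mathrm{Pr}\{T_n\in\mathrm{d}s\}=\sum_{j_0=1}^{k_0}\mu_{j_0}e^{-s\mu}\,\mathrm{d}s\sum_{m=1}^{n}\sum_{r=0}^{\infty}\sum_{\Omega(k,n-m)}\Big(\prod_{j=1}^{k}\frac{(r\lambda_j)^{x_j}}{x_j!}\Big)e^{-r\lambda}\cdot\sum_{\Omega(k,m)}\Big(\prod_{j=1}^{k}\frac{(j_0\lambda_j)^{n_j}}{n_j!}\Big)e^{-j_0\lambda}\cdot\sum_{\Omega(k_0,r)}\prod_{i=1}^{k_0}\frac{(s\mu_i)^{y_i}}{y_i!},$$ where the sums run over $(x_1,\dots,x_k)\in\Omega(k,n-m)$, $(n_1,\dots,n_k)\in\Omega(k,m)$ and $(y_1,\dots,y_{k_0})\in\Omega(k_0,r)$.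
   Context: A generalized counting process (GCP) $\{M(t)\}_{t\ge0}$ with positive rates $\lambda_1,\dots,\lambda_k$ is a right-continuous $\mathbb{N}_0$-valued process with $M(0)=0$ and stationary independent increments, whose probability generating function is $\mathbb{E}(u^{M(t)})=\exp\big(-t\sum_{j=1}^{k}\lambda_j(1-u^j)\big)$, $|u|\le1$. The process $\hat M(t)=M(M_0(t))$ is called the iterated generalized counting process (IGCP). For integers $k\ge1,m\ge0$, $\Omega(k,m)=\{(x_1,\dots,x_k)\in\mathbb{N}_0^k: x_1+2x_2+\dots+kx_k=m\}$. Convention $0^0=1$. The notation $\mathrm{Pr}\{T_n\in\mathrm{d}s\}=f(s)\,\mathrm{d}s$ means that the law of $T_n$ restricted to $(0,\infty)$ has density $f$ with respect to Lebesgue measure ($T_n=\infty$ may have positive probability). *)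

theory Defs
  imports "HOL-Probability.Probability"
begin

text \<open>
  Processes are indexed by \<^term>\<open>t :: real\<close>; only \<^term>\<open>t \<ge> 0\<close> is constrained. Increments are
  taken in \<^typ>\<open>int\<close>, because subtraction on \<^typ>\<open>nat\<close> truncates. The rates are
  \<^term>\<open>rate 1\<close>, ..., \<^term>\<open>rate k\<close>. Right-continuity holds for every path, with
  respect to the discrete topology of \<^typ>\<open>nat\<close>.
\<close>

locale generalized_counting_process = prob_space P
  for P :: "'a measure" and k :: nat and rate :: "nat \<Rightarrow> real" and X :: "real \<Rightarrow> 'a \<Rightarrow> nat" +
  assumes k_pos: "1 \<le> k"
    and rate_pos: "\<And>j. j \<in> {1..k} \<Longrightarrow> 0 < rate j"
    and random_variable_X: "\<And>t. 0 \<le> t \<Longrightarrow> X t \<in> measurable P (count_space UNIV)"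
    and X_0: "\<And>\<omega>. \<omega> \<in> space P \<Longrightarrow> X 0 \<omega> = 0"
    and right_continuous:
      "\<And>\<omega> t. \<omega> \<in> space P \<Longrightarrow> 0 \<le> t \<Longrightarrow> continuous (at_right t) (\<lambda>s. X s \<omega>)"
    and stationary_increments:
      "\<And>s h. 0 \<le> s \<Longrightarrow> 0 \<le> h \<Longrightarrow>
         distr P (count_space UNIV) (\<lambda>\<omega>. int (X (s + h) \<omega>) - int (X s \<omega>)) =
         distr P (count_space UNIV) (\<lambda>\<omega>. int (X h \<omega>) - int (X 0 \<omega>))"
    and independent_increments:
      "\<And>(N :: nat) (\<tau> :: nat \<Rightarrow> real). 0 \<le> \<tau> 0 \<Longrightarrow> (\<And>i. i < N \<Longrightarrow> \<tau> i < \<tau> (Suc i)) \<Longrightarrow>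
         indep_vars (\<lambda>_. count_space UNIV)
           (\<lambda>i \<omega>. int (X (\<tau> (Suc i)) \<omega>) - int (X (\<tau> i) \<omega>)) {..<N}"
    and pgf:
      "\<And>t u. 0 \<le> t \<Longrightarrow> \<bar>u\<bar> \<le> 1 \<Longrightarrow>
         expectation (\<lambda>\<omega>. u ^ X t \<omega>) = exp (- t * (\<Sum>j=1..k. rate j * (1 - u ^ j)))"

text \<open>
  Independence of two processes as random elements of the product space over the time set
  \<open>[0, \<infinity>)\<close>, i.e. independence of the sigma-algebras they generate.
\<close>

definition independent_processes ::
    "'a measure \<Rightarrow> (real \<Rightarrow> 'a \<Rightarrow> nat) \<Rightarrow> (real \<Rightarrow> 'a \<Rightarrow> nat) \<Rightarrow> bool" where
  "independent_processes P X Y \<longleftrightarrow>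
     prob_space.indep_var P
       (PiM {0..} (\<lambda>_. count_space UNIV)) (\<lambda>\<omega>. \<lambda>t\<in>{0..}. X t \<omega>)
       (PiM {0..} (\<lambda>_. count_space UNIV)) (\<lambda>\<omega>. \<lambda>t\<in>{0..}. Y t \<omega>)"

definition iterated_process ::
    "(real \<Rightarrow> 'a \<Rightarrow> nat) \<Rightarrow> (real \<Rightarrow> 'a \<Rightarrow> nat) \<Rightarrow> real \<Rightarrow> 'a \<Rightarrow> nat" where
  "iterated_process X X0 t \<omega> = X (real (X0 t \<omega>)) \<omega>"

definition first_passage_time :: "(real \<Rightarrow> 'a \<Rightarrow> nat) \<Rightarrow> nat \<Rightarrow> 'a \<Rightarrow> ereal" where
  "first_passage_time X n \<omega> = Inf (ereal ` {s. 0 < s \<and> X s \<omega> = n})"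

text \<open>
  The law of \<^term>\<open>T\<close>, restricted to \<open>(0, \<infinity>)\<close>, has density \<^term>\<open>f\<close> with respect to Lebesgue
  measure; nothing is said about the mass at \<open>\<infinity>\<close> or about the values of \<^term>\<open>f\<close> off
  \<open>(0, \<infinity>)\<close>.
\<close>

definition has_density_on_pos :: "'a measure \<Rightarrow> ('a \<Rightarrow> ereal) \<Rightarrow> (real \<Rightarrow> ennreal) \<Rightarrow> bool" where
  "has_density_on_pos P T f \<longleftrightarrow>
     T \<in> borel_measurable P \<and>
     f \<in> borel_measurable (restrict_space lborel {0<..}) \<and>
     (\<forall>A\<in>sets borel. A \<subseteq> {0<..} \<longrightarrow>
        emeasure (distr P borel T) (ereal ` A) = (\<integral>\<^sup>+s\<in>A. f s \<partial>lborel))"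

text \<open>Tuples indexed by \<open>{1..k}\<close> are extensional functions, so each tuple is counted once.\<close>

definition Omega :: "nat \<Rightarrow> nat \<Rightarrow> (nat \<Rightarrow> nat) set" where
  "Omega k m = {x \<in> {1..k} \<rightarrow>\<^sub>E UNIV. (\<Sum>j=1..k. j * x j) = m}"

lemma finite_Omega: "finite (Omega k m)"
proof (rule finite_subset)
  show "Omega k m \<subseteq> {1..k} \<rightarrow>\<^sub>E {..m}"
  proof
    fix x assume x: "x \<in> Omega k m"
    have "x j \<le> m" if "j \<in> {1..k}" for j
    proof -
      have "x j \<le> j * x j" using that by simp
      also have "\<dots> \<le> (\<Sum>j=1..k. j * x j)"
        using that by (intro member_le_sum) auto
      finally show ?thesis using x by (simp add: Omega_def)
    qed
    with x show "x \<in> {1..k} \<rightarrow>\<^sub>E {..m}"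
      by (auto simp: Omega_def PiE_def Pi_def)
  qed
qed (auto intro: finite_PiE)

end

theory Submission
  imports Defs
begin

text \<open>
  Write \<open>Y = M \<circ> M\<^sub>0\<close>. At two times \<open>s\<close> and \<open>s + h\<close> the process \<open>Y\<close> has stationary independent
  nonnegative increments, and \<open>\<P>(Y h = m) = h q\<^sub>m + O(h\<^sup>2)\<close> for \<open>m \<ge> 1\<close>, where
  \<open>q\<^sub>m = \<Sum>\<^sub>j \<mu>\<^sub>j \<P>(M j = m)\<close>. Almost every path is nondecreasing, so \<open>Y\<close> visits \<open>n\<close> on the grid
  \<open>h, 2h, \<dots>\<close> exactly when some grid step leads from \<open>n - m\<close> to \<open>n\<close> with \<open>m \<ge> 1\<close>, and at most one
  step does. Hence the probability of a visit on the grid is a Riemann sum of the Lipschitz function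
  \<open>\<Sum>\<^sub>m \<P>(Y s = n - m) q\<^sub>m\<close> up to an error \<open>O(h)\<close>. By right continuity, the visits on dyadic
  grids exhaust the event \<open>T\<^sub>n < t\<close>, so \<open>\<P>(T\<^sub>n < t)\<close> is the integral of that function over
  \<open>[0, t]\<close>.
\<close>

section \<open>The law of a generalized counting process\<close>

text \<open>Induction on the index: once the first \<open>n\<close> coefficients of the difference
  vanish, dividing by \<open>u ^ n\<close> leaves a power series with sum 0 for small
  \<open>u \<noteq> 0\<close>. Its limit at 0 is the next coefficient.\<close>

lemma powser_unique:
  fixes a b :: "nat \<Rightarrow> real"
  assumes a: "\<And>u. \<bar>u\<bar> < 1 \<Longrightarrow> (\<lambda>n. a n * u ^ n) sums f u"
    and b: "\<And>u. \<bar>u\<bar> < 1 \<Longrightarrow> (\<lambda>n. b n * u ^ n) sums f u"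
  shows "a n = b n"
proof (induction n rule: less_induct)
  case (less n)
  define c where "c i = a i - b i" for i
  have c0: "c i = 0" if "i < n" for i
    using less that by (simp add: c_def)
  have *: "(\<lambda>i. c (i + n) * u ^ i) sums 0" if "u \<noteq> 0" "norm u < 1" for u
  proof -
    have "(\<lambda>i. c i * u ^ i) sums 0"
      using sums_diff[OF a b, of u u] that by (simp add: c_def left_diff_distrib)
    then have "(\<lambda>i. c (i + n) * u ^ (i + n)) sums 0"
      by (subst sums_iff_shift) (simp add: c0)
    then have "(\<lambda>i. c (i + n) * u ^ (i + n) / u ^ n) sums (0 / u ^ n)"
      by (rule sums_divide)
    with that show ?thesis by (simp add: power_add)
  qed
  have "((\<lambda>u. 0) \<longlongrightarrow> c (0 + n)) (at (0::real))"
    by (rule powser_limit_0_strong[of 1 "\<lambda>i. c (i + n)" "\<lambda>_. 0"]) (use * in auto)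
  then show ?case
    by (simp add: c_def tendsto_const_iff)
qed

text \<open>The state probability without its factor \<open>exp (- t * total_rate)\<close>. The sum
  over \<open>Omega k\<^sub>0 r\<close> in the theorem has exactly this unnormalised form.\<close>

definition gcp_weight :: "nat \<Rightarrow> (nat \<Rightarrow> real) \<Rightarrow> real \<Rightarrow> nat \<Rightarrow> real" where
  "gcp_weight k rate t m = (\<Sum>x\<in>Omega k m. \<Prod>j=1..k. (t * rate j) ^ x j / fact (x j))"

text \<open>Each factor \<open>exp (t * rate j * u ^ j)\<close> is expanded, and the
  \<open>k\<close> absolutely convergent series are multiplied into one sum over all tuples. A tuple
  in \<open>Omega k m\<close> contributes to \<open>u ^ m\<close>.\<close>

lemma gcp_weight_sums:
  "(\<lambda>m. gcp_weight k rate t m * u ^ m) sums exp (\<Sum>j=1..k. t * rate j * u ^ j)"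
proof -
  define f where "f j x = (t * rate j * u ^ j) ^ x / fact x" for j x :: nat
  define g where "g x = (\<Prod>j\<in>{1..k}. f j (x j))" for x
  let ?E = "{1..k} \<rightarrow>\<^sub>E (UNIV :: nat set)"
  have norm_f: "summable (\<lambda>x. norm (f j x))" for j
    using summable_norm_exp[of "t * rate j * u ^ j"] by (simp add: f_def divide_inverse mult.commute)
  have f_abs: "(\<lambda>x. norm (f j x)) summable_on UNIV" for j
    using norm_summable_imp_summable_on[of "\<lambda>x. norm (f j x)"] norm_f by simp
  have f_sum: "infsum (f j) UNIV = exp (t * rate j * u ^ j)" for j
  proof -
    have "f j sums exp (t * rate j * u ^ j)"
      unfolding f_def using exp_converges[of "t * rate j * u ^ j"] by (simp add: field_simps)
    then have "(f j has_sum exp (t * rate j * u ^ j)) UNIV"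
      by (rule norm_summable_imp_has_sum[OF norm_f])
    then show ?thesis by (rule infsumI)
  qed
  have g_sum: "g summable_on ?E"
  proof -
    have "Infinite_Set_Sum.abs_summable_on g ?E"
      unfolding g_def using f_abs
      by (intro abs_summable_on_prod_PiE) (auto simp: abs_summable_equivalent[symmetric])
    then show ?thesis
      by (auto simp: abs_summable_equivalent[symmetric] intro: abs_summable_summable)
  qed
  have "infsum g ?E = (\<Prod>j\<in>{1..k}. infsum (f j) UNIV)"
    unfolding g_def by (rule infsum_prod_PiE_abs) (use f_abs in auto)
  then have "infsum g ?E = exp (\<Sum>j=1..k. t * rate j * u ^ j)"
    by (simp add: f_sum exp_sum)
  with g_sum have "(g has_sum exp (\<Sum>j=1..k. t * rate j * u ^ j)) ?E"
    by (metis has_sum_infsum)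
  \<comment> \<open>Tuples are sorted by their weight \<open>\<Sum>j=1..k. j * x j\<close>; each
    fibre \<open>Omega k m\<close> is finite.\<close>
  also have "?this \<longleftrightarrow> ((\<lambda>(m, x). g x) has_sum exp (\<Sum>j=1..k. t * rate j * u ^ j)) (Sigma UNIV (Omega k))"
    by (rule has_sum_reindex_bij_witness[where i = snd and j = "\<lambda>x. (\<Sum>j=1..k. j * x j, x)"])
       (auto simp: Omega_def PiE_def extensional_def)
  finally have "((\<lambda>m. \<Sum>x\<in>Omega k m. g x) has_sum exp (\<Sum>j=1..k. t * rate j * u ^ j)) UNIV"
    by (rule has_sum_Sigma') (auto intro: has_sum_finite finite_Omega)
  then have "(\<lambda>m. \<Sum>x\<in>Omega k m. g x) sums exp (\<Sum>j=1..k. t * rate j * u ^ j)"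
    by (rule has_sum_imp_sums)
  moreover have "(\<Sum>x\<in>Omega k m. g x) = gcp_weight k rate t m * u ^ m" for m
    unfolding gcp_weight_def sum_distrib_right
  proof (rule sum.cong[OF refl])
    fix x assume "x \<in> Omega k m"
    then have "m = (\<Sum>j=1..k. j * x j)" by (simp add: Omega_def)
    then have "u ^ m = (\<Prod>j=1..k. (u ^ j) ^ x j)"
      by (simp add: power_sum power_mult)
    then show "g x = (\<Prod>j=1..k. (t * rate j) ^ x j / fact (x j)) * u ^ m"
      by (simp add: g_def f_def power_mult_distrib prod.distrib[symmetric])
  qed
  ultimately show ?thesis by simp
qed

lemma gcp_weight_0: "gcp_weight k rate t 0 = 1"
proof -
  have "Omega k 0 = {\<lambda>j\<in>{1..k}. 0}"
    by (auto simp: Omega_def PiE_def extensional_def fun_eq_iff)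
  then show ?thesis by (simp add: gcp_weight_def)
qed

text \<open>The summand below comes from the tuple that is 1 at position \<^term>\<open>r\<close> and 0 elsewhere.\<close>

lemma gcp_weight_ge:
  assumes "0 \<le> t" "\<And>j. j \<in> {1..k} \<Longrightarrow> 0 \<le> rate j" and r: "r \<in> {1..k}"
  shows "t * rate r \<le> gcp_weight k rate t r"
proof -
  define e :: "nat \<Rightarrow> nat" where "e = (\<lambda>j\<in>{1..k}. if j = r then 1 else 0)"
  have "(\<Sum>j=1..k. j * e j) = (\<Sum>j=1..k. if j = r then r else 0)"
    by (intro sum.cong) (auto simp: e_def)
  with r have "e \<in> Omega k r"
    by (auto simp: Omega_def e_def)
  have "(\<Prod>j=1..k. (t * rate j) ^ e j / fact (e j)) = (\<Prod>j=1..k. if j = r then t * rate r else 1)"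
    by (intro prod.cong) (auto simp: e_def)
  also have "\<dots> = t * rate r"
    using r by simp
  finally have "t * rate r = (\<Sum>x\<in>{e}. \<Prod>j=1..k. (t * rate j) ^ x j / fact (x j))"
    by simp
  also have "\<dots> \<le> gcp_weight k rate t r"
    unfolding gcp_weight_def using \<open>e \<in> Omega k r\<close> assms
    by (intro sum_mono2 finite_Omega prod_nonneg) auto
  finally show ?thesis .
qed

section \<open>State probabilities and increments of a single process\<close>

context generalized_counting_process
begin

definition state_prob :: "real \<Rightarrow> nat \<Rightarrow> real" where
  "state_prob t m = \<P>(\<omega> in P. X t \<omega> = m)"

definition total_rate :: real where
  "total_rate = (\<Sum>j=1..k. rate j)"

lemmas [measurable] = random_variable_X

lemma state_prob_nonneg: "0 \<le> state_prob t m"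
  by (simp add: state_prob_def)

lemma state_prob_le_1: "state_prob t m \<le> 1"
  by (simp add: state_prob_def)

lemma total_rate_nonneg: "0 \<le> total_rate"
  unfolding total_rate_def using rate_pos by (intro sum_nonneg) (auto intro: less_imp_le)

lemma state_prob_0: "state_prob 0 m = (if m = 0 then 1 else 0)"
proof -
  have "{\<omega> \<in> space P. X 0 \<omega> = m} = (if m = 0 then space P else {})"
    using X_0 by auto
  then show ?thesis by (simp add: state_prob_def prob_space)
qed

text \<open>The variable \<open>u ^ X t\<close> is split over the values of \<open>X t\<close>;
  since \<open>\<bar>u\<bar> \<le> 1\<close>, the state probabilities dominate the terms and justify
  exchanging sum and expectation.\<close>

lemma state_prob_sums_pgf:
  assumes "0 \<le> t" "\<bar>u\<bar> \<le> 1"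
  shows "(\<lambda>m. state_prob t m * u ^ m) sums expectation (\<lambda>\<omega>. u ^ X t \<omega>)"
proof -
  have [measurable]: "X t \<in> P \<rightarrow>\<^sub>M count_space UNIV"
    using assms by simp
  let ?f = "\<lambda>m \<omega>. indicator {\<omega>\<in>space P. X t \<omega> = m} \<omega> * u ^ m"
  have int: "integrable P (?f m)" for m
    by (intro integrable_mult_left integrable_real_indicator) (auto simp: emeasure_eq_measure)
  have nrm: "norm (?f m \<omega>) = indicator {\<omega>\<in>space P. X t \<omega> = m} \<omega> * \<bar>u\<bar> ^ m" for m \<omega>
    by (simp add: indicator_def power_abs)
  have eq: "?f m \<omega> = (if m = X t \<omega> then u ^ X t \<omega> else 0)" if "\<omega> \<in> space P" for m \<omega>
    using that by (simp add: indicator_def)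
  have "(\<lambda>m. integral\<^sup>L P (?f m)) sums (\<integral>\<omega>. (\<Sum>m. ?f m \<omega>) \<partial>P)"
  proof (rule sums_integral[OF int])
    show "AE \<omega> in P. summable (\<lambda>m. norm (?f m \<omega>))"
      unfolding nrm by (auto intro!: AE_I2 summable_finite[of "{X t \<omega>}" for \<omega>] simp: indicator_def)
    have "summable (\<lambda>m. measure P {\<omega>\<in>space P. X t \<omega> = m})"
    proof -
      have "(\<lambda>m. measure P {\<omega>\<in>space P. X t \<omega> = m}) sums measure P (\<Union>m. {\<omega>\<in>space P. X t \<omega> = m})"
        by (rule finite_measure_UNION) (auto simp: disjoint_family_on_def)
      then show ?thesis by (simp add: sums_iff)
    qed
    then have "summable (\<lambda>m. measure P {\<omega>\<in>space P. X t \<omega> = m} * \<bar>u\<bar> ^ m)"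
      by (rule summable_comparison_test'[where N = 0])
         (use assms in \<open>auto simp: abs_mult power_abs intro!: mult_left_le power_le_one\<close>)
    then show "summable (\<lambda>m. \<integral>\<omega>. norm (?f m \<omega>) \<partial>P)"
      unfolding nrm by simp
  qed
  moreover have "(\<integral>\<omega>. (\<Sum>m. ?f m \<omega>) \<partial>P) = expectation (\<lambda>\<omega>. u ^ X t \<omega>)"
  proof (intro Bochner_Integration.integral_cong refl)
    fix \<omega> assume "\<omega> \<in> space P"
    then have "(\<lambda>m. ?f m \<omega>) sums (u ^ X t \<omega>)"
      using sums_single[of "X t \<omega>" "\<lambda>m. u ^ X t \<omega>"] by (simp add: eq)
    then show "(\<Sum>m. ?f m \<omega>) = u ^ X t \<omega>" by (simp add: sums_iff)
  qed
  ultimately show ?thesis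
    by (simp add: state_prob_def)
qed

text \<open>Both sides are coefficients of the same generating function on
  \<open>\<bar>u\<bar> < 1\<close>, so \<open>powser_unique\<close> applies.\<close>

lemma state_prob_eq:
  assumes "0 \<le> t"
  shows "state_prob t m = gcp_weight k rate t m * exp (- t * total_rate)"
proof (rule powser_unique[where a = "state_prob t"
        and b = "\<lambda>m. gcp_weight k rate t m * exp (- t * total_rate)"
        and f = "\<lambda>u. expectation (\<lambda>\<omega>. u ^ X t \<omega>)"])
  fix u :: real assume "\<bar>u\<bar> < 1"
  then show "(\<lambda>m. state_prob t m * u ^ m) sums expectation (\<lambda>\<omega>. u ^ X t \<omega>)"
    using state_prob_sums_pgf assms by simp
  have "expectation (\<lambda>\<omega>. u ^ X t \<omega>) = exp (\<Sum>j=1..k. t * rate j * u ^ j) * exp (- t * total_rate)"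
    using pgf[of t u] assms \<open>\<bar>u\<bar> < 1\<close>
    by (simp add: total_rate_def right_diff_distrib sum_subtractf sum_distrib_left
        sum_distrib_right mult.assoc sum_negf exp_add[symmetric])
  then show "(\<lambda>m. gcp_weight k rate t m * exp (- t * total_rate) * u ^ m)
      sums expectation (\<lambda>\<omega>. u ^ X t \<omega>)"
    using sums_mult2[OF gcp_weight_sums[of k rate t u], of "exp (- t * total_rate)"]
    by (simp add: algebra_simps)
qed

lemma state_prob_sums: "0 \<le> t \<Longrightarrow> state_prob t sums 1"
  using state_prob_sums_pgf[of t 1] by (simp add: prob_space)

lemma state_prob_stay: "0 \<le> t \<Longrightarrow> state_prob t 0 = exp (- t * total_rate)"
  by (simp add: state_prob_eq gcp_weight_0)

text \<open>Nonnegativity depends only on the law of the increment, which by stationarity is that of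
  the \<open>nat\<close>-valued \<open>X h\<close>. The null set depends on the pair of
  times.\<close>

lemma AE_mono_increment:
  assumes "0 \<le> s" "0 \<le> h"
  shows "AE \<omega> in P. X s \<omega> \<le> X (s + h) \<omega>"
proof -
  have "AE x in distr P (count_space UNIV) (\<lambda>\<omega>. int (X h \<omega>) - int (X 0 \<omega>)). 0 \<le> x"
    using assms by (subst AE_distr_iff) (auto simp: X_0)
  then have "AE x in distr P (count_space UNIV) (\<lambda>\<omega>. int (X (s + h) \<omega>) - int (X s \<omega>)). 0 \<le> x"
    by (simp only: stationary_increments[OF assms])
  then show ?thesis
    using assms by (subst (asm) AE_distr_iff) auto
qed

lemma prob_increment:
  assumes "0 \<le> s" "0 \<le> h"
  shows "\<P>(\<omega> in P. X (s + h) \<omega> = X s \<omega> + b) = state_prob h b"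
proof -
  have "\<P>(\<omega> in P. X (s + h) \<omega> = X s \<omega> + b) =
      prob ((\<lambda>\<omega>. int (X (s + h) \<omega>) - int (X s \<omega>)) -` {int b} \<inter> space P)"
    by (rule arg_cong[where f = prob]) auto
  also have "\<dots> = measure (distr P (count_space UNIV) (\<lambda>\<omega>. int (X (s + h) \<omega>) - int (X s \<omega>))) {int b}"
    using assms by (subst measure_distr) auto
  also have "\<dots> = measure (distr P (count_space UNIV) (\<lambda>\<omega>. int (X h \<omega>) - int (X 0 \<omega>))) {int b}"
    by (simp only: stationary_increments[OF assms])
  also have "\<dots> = prob ((\<lambda>\<omega>. int (X h \<omega>) - int (X 0 \<omega>)) -` {int b} \<inter> space P)"
    using assms by (subst measure_distr) auto
  also have "(\<lambda>\<omega>. int (X h \<omega>) - int (X 0 \<omega>)) -` {int b} \<inter> space P = {\<omega> \<in> space P. X h \<omega> = b}"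
    using X_0 by auto
  finally show ?thesis by (simp add: state_prob_def)
qed

lemma prob_two_states:
  assumes "0 \<le> s" "0 \<le> h"
  shows "\<P>(\<omega> in P. X s \<omega> = a \<and> X (s + h) \<omega> = a + b) = state_prob s a * state_prob h b"
proof -
  \<comment> \<open>The axiom on independent increments asks for strictly increasing times, so
    degenerate intervals are treated by hand.\<close>
  consider "s = 0" | "0 < s" "h = 0" | "0 < s" "0 < h"
    using assms by fastforce
  then show ?thesis
  proof cases
    case 1
    have "{\<omega> \<in> space P. X s \<omega> = a \<and> X (s + h) \<omega> = a + b} =
        (if a = 0 then {\<omega> \<in> space P. X h \<omega> = b} else {})"
      using X_0 1 by auto
    then show ?thesis
      using 1 by (simp add: state_prob_0) (simp add: state_prob_def)
  next
    case 2
    then have "{\<omega> \<in> space P. X s \<omega> = a \<and> X (s + h) \<omega> = a + b} =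
        (if b = 0 then {\<omega> \<in> space P. X s \<omega> = a} else {})"
      by auto
    then show ?thesis
      using 2 by (simp add: state_prob_0) (simp add: state_prob_def)
  next
    case 3
    \<comment> \<open>Starting at time 0 turns \<open>X s\<close> itself into an increment, because
      \<open>X 0 = 0\<close>.\<close>
    define \<tau> where "\<tau> i = (if i = 0 then 0 else if i = 1 then s else s + h)" for i :: nat
    let ?D = "\<lambda>i \<omega>. int (X (\<tau> (Suc i)) \<omega>) - int (X (\<tau> i) \<omega>)"
    let ?A = "\<lambda>i::nat. if i = 0 then {int a} else {int b}"
    have "indep_vars (\<lambda>_. count_space UNIV) ?D {..<2::nat}"
      by (rule independent_increments) (use 3 in \<open>auto simp: \<tau>_def\<close>)
    then have "prob (\<Inter>i\<in>{..<2}. ?D i -` ?A i \<inter> space P) = (\<Prod>i\<in>{..<2}. prob (?D i -` ?A i \<inter> space P))"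
      by (rule indep_varsD) (auto simp: lessThan_nat_numeral lessThan_Suc)
    moreover have "(\<Inter>i\<in>{..<2::nat}. ?D i -` ?A i \<inter> space P) =
        {\<omega> \<in> space P. X s \<omega> = a \<and> X (s + h) \<omega> = a + b}"
      using X_0 by (auto simp: \<tau>_def lessThan_nat_numeral lessThan_Suc)
    moreover have "?D 0 -` ?A 0 \<inter> space P = {\<omega> \<in> space P. X s \<omega> = a}"
      using X_0 by (auto simp: \<tau>_def)
    moreover have "?D 1 -` ?A 1 \<inter> space P = {\<omega> \<in> space P. X (s + h) \<omega> = X s \<omega> + b}"
      by (auto simp: \<tau>_def)
    ultimately show ?thesis
      using prob_increment[of s h b] 3
      by (simp add: state_prob_def lessThan_nat_numeral lessThan_Suc mult.commute)
  qed
qed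

end

section \<open>The iterated process\<close>

text \<open>\<open>M\<^sub>0\<close> is the random clock, and its facts carry the prefix
  \<open>base\<close>. Unprefixed \<open>state_prob\<close> and \<open>total_rate\<close> belong to
  \<open>M\<close>.\<close>

locale independent_gcps = generalized_counting_process P k l M +
  base: generalized_counting_process P k\<^sub>0 \<mu> M\<^sub>0
  for P :: "'a measure" and k l M k\<^sub>0 \<mu> M\<^sub>0 +
  assumes independent: "independent_processes P M\<^sub>0 M"
begin

abbreviation Y :: "real \<Rightarrow> 'a \<Rightarrow> nat" where
  "Y \<equiv> iterated_process M M\<^sub>0"

definition iter_prob :: "real \<Rightarrow> nat \<Rightarrow> real" where
  "iter_prob t m = \<P>(\<omega> in P. Y t \<omega> = m)"

lemmas [measurable] = base.random_variable_X

lemma measurable_Y [measurable]: "0 \<le> t \<Longrightarrow> Y t \<in> P \<rightarrow>\<^sub>M count_space UNIV"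
  unfolding iterated_process_def
  by (rule measurable_compose_countable[where f = "\<lambda>i. M (real i)" and g = "M\<^sub>0 t"]) simp_all

text \<open>Events at finitely many fixed times are cylinder sets of the path space, so independence
  of the processes factors them. Two times per process suffice for everything below; a single time
  is obtained by repeating it.\<close>

lemma prob_joint:
  assumes "0 \<le> s" "0 \<le> s'" "0 \<le> t" "0 \<le> t'"
  shows "\<P>(\<omega> in P. M\<^sub>0 s \<omega> = r \<and> M\<^sub>0 s' \<omega> = r' \<and> M t \<omega> = a \<and> M t' \<omega> = a') =
    \<P>(\<omega> in P. M\<^sub>0 s \<omega> = r \<and> M\<^sub>0 s' \<omega> = r') * \<P>(\<omega> in P. M t \<omega> = a \<and> M t' \<omega> = a')"
proof -
  let ?N = "PiM {0..} (\<lambda>_. count_space UNIV) :: (real \<Rightarrow> nat) measure"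
  let ?A = "{f \<in> space ?N. f s = r \<and> f s' = r'}" and ?B = "{f \<in> space ?N. f t = a \<and> f t' = a'}"
  have [measurable]: "(\<lambda>f. f x) \<in> ?N \<rightarrow>\<^sub>M count_space UNIV" if "0 \<le> x" for x
    using that by (intro measurable_component_singleton) auto
  have "?A \<in> sets ?N" "?B \<in> sets ?N"
    using assms by measurable
  then have "prob ((\<lambda>x. (\<lambda>t\<in>{0..}. M\<^sub>0 t x, \<lambda>t\<in>{0..}. M t x)) -` (?A \<times> ?B) \<inter> space P) =
      prob ((\<lambda>x. \<lambda>t\<in>{0..}. M\<^sub>0 t x) -` ?A \<inter> space P) * prob ((\<lambda>x. \<lambda>t\<in>{0..}. M t x) -` ?B \<inter> space P)"
    using independent unfolding independent_processes_def by (rule indep_varD[rotated])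
  moreover have "(\<lambda>x. (\<lambda>t\<in>{0..}. M\<^sub>0 t x, \<lambda>t\<in>{0..}. M t x)) -` (?A \<times> ?B) \<inter> space P =
      {\<omega> \<in> space P. M\<^sub>0 s \<omega> = r \<and> M\<^sub>0 s' \<omega> = r' \<and> M t \<omega> = a \<and> M t' \<omega> = a'}"
    "(\<lambda>x. \<lambda>t\<in>{0..}. M\<^sub>0 t x) -` ?A \<inter> space P = {\<omega> \<in> space P. M\<^sub>0 s \<omega> = r \<and> M\<^sub>0 s' \<omega> = r'}"
    "(\<lambda>x. \<lambda>t\<in>{0..}. M t x) -` ?B \<inter> space P = {\<omega> \<in> space P. M t \<omega> = a \<and> M t' \<omega> = a'}"
    using assms by (auto simp: space_PiM)
  ultimately show ?thesis by simp
qed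

lemma iter_prob_sums:
  assumes "0 \<le> t"
  shows "(\<lambda>r. base.state_prob t r * state_prob (real r) m) sums iter_prob t m"
proof -
  have "(\<lambda>r. prob {\<omega> \<in> space P. M\<^sub>0 t \<omega> = r \<and> M (real r) \<omega> = m}) sums
      prob (\<Union>r. {\<omega> \<in> space P. M\<^sub>0 t \<omega> = r \<and> M (real r) \<omega> = m})"
    using assms by (intro finite_measure_UNION) (auto simp: disjoint_family_on_def)
  moreover have "(\<Union>r. {\<omega> \<in> space P. M\<^sub>0 t \<omega> = r \<and> M (real r) \<omega> = m}) = {\<omega> \<in> space P. Y t \<omega> = m}"
    by (auto simp: iterated_process_def)
  moreover have "prob {\<omega> \<in> space P. M\<^sub>0 t \<omega> = r \<and> M (real r) \<omega> = m} =
      base.state_prob t r * state_prob (real r) m" for r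
    using prob_joint[of t t "real r" "real r" r r m m] assms
    by (simp add: state_prob_def base.state_prob_def)
  ultimately show ?thesis
    by (simp add: iter_prob_def)
qed

text \<open>Fixing the clock value \<open>r\<close> and its increment \<open>j\<close> reduces the
  event to two fixed intervals for each process. The resulting probability is a product of a term in
  \<open>r\<close> and a term in \<open>j\<close>, so the double sum separates.\<close>

lemma iter_prob_two_states:
  assumes s: "0 \<le> s" and h: "0 \<le> h"
  shows "\<P>(\<omega> in P. Y s \<omega> = a \<and> Y (s + h) \<omega> = a + b) = iter_prob s a * iter_prob h b"
proof -
  note [measurable] = measurable_Y[OF s] measurable_Y[OF add_nonneg_nonneg[OF s h]]
    base.random_variable_X[OF s] base.random_variable_X[OF add_nonneg_nonneg[OF s h]]
  \<comment> \<open>The condition \<open>r \<le> M\<^sub>0 (s + h) \<omega>\<close> lets the later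
    clock value be written as \<open>r + j\<close>; it removes only a null set.\<close>
  define B where "B r = {\<omega> \<in> space P. M\<^sub>0 s \<omega> = r \<and> r \<le> M\<^sub>0 (s + h) \<omega> \<and> Y s \<omega> = a \<and> Y (s + h) \<omega> = a + b}" for r
  define C where "C r j = {\<omega> \<in> space P. M\<^sub>0 s \<omega> = r \<and> M\<^sub>0 (s + h) \<omega> = r + j \<and>
      M (real r) \<omega> = a \<and> M (real r + real j) \<omega> = a + b}" for r j
  have probC: "prob (C r j) =
      (base.state_prob s r * state_prob (real r) a) * (base.state_prob h j * state_prob (real j) b)" for r j
    unfolding C_def using s h
    by (simp add: prob_joint base.prob_two_states prob_two_states)
  have "prob (B r) = (base.state_prob s r * state_prob (real r) a) * iter_prob h b" for r
  proof -
    have "(\<lambda>j. prob (C r j)) sums prob (\<Union>j. C r j)"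
      unfolding C_def using s h by (intro finite_measure_UNION) (auto simp: disjoint_family_on_def)
    moreover have "(\<Union>j. C r j) = B r"
      by (auto simp: B_def C_def iterated_process_def le_iff_add)
    moreover have "(\<lambda>j. prob (C r j)) sums ((base.state_prob s r * state_prob (real r) a) * iter_prob h b)"
      unfolding probC by (intro sums_mult iter_prob_sums h)
    ultimately show ?thesis
      using sums_unique2 by metis
  qed
  moreover have "(\<lambda>r. prob (B r)) sums prob (\<Union>r. B r)"
    unfolding B_def by (intro finite_measure_UNION) (auto simp: disjoint_family_on_def)
  ultimately have "prob (\<Union>r. B r) = iter_prob s a * iter_prob h b"
    using sums_mult2[OF iter_prob_sums[OF s, of a], of "iter_prob h b"] sums_unique2 by fastforce
  moreover have "\<P>(\<omega> in P. Y s \<omega> = a \<and> Y (s + h) \<omega> = a + b) = prob (\<Union>r. B r)"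
  proof (rule measure_eq_AE)
    show "AE \<omega> in P. \<omega> \<in> {\<omega> \<in> space P. Y s \<omega> = a \<and> Y (s + h) \<omega> = a + b} \<longleftrightarrow> \<omega> \<in> (\<Union>r. B r)"
      using base.AE_mono_increment[OF s h] by eventually_elim (auto simp: B_def)
  qed (auto simp: B_def)
  ultimately show ?thesis by simp
qed

text \<open>Clock values are natural numbers, so countably many pairs of times for \<open>M\<close>
  matter and one null set covers them all.\<close>

lemma AE_Y_mono:
  assumes "0 \<le> s" "0 \<le> h"
  shows "AE \<omega> in P. Y s \<omega> \<le> Y (s + h) \<omega>"
proof -
  have "AE \<omega> in P. \<forall>r j. M (real r) \<omega> \<le> M (real r + real j) \<omega>"
    by (simp add: AE_all_countable AE_mono_increment)
  with base.AE_mono_increment[OF assms] show ?thesis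
  proof eventually_elim
    case (elim \<omega>)
    then obtain j where "M\<^sub>0 (s + h) \<omega> = M\<^sub>0 s \<omega> + j"
      using le_Suc_ex by blast
    then show ?case using elim by (simp add: iterated_process_def)
  qed
qed

lemma Y_0: "\<omega> \<in> space P \<Longrightarrow> Y 0 \<omega> = 0"
  by (simp add: iterated_process_def X_0 base.X_0)

lemma iter_prob_nonneg: "0 \<le> iter_prob t m" and iter_prob_le_1: "iter_prob t m \<le> 1"
  by (simp_all add: iter_prob_def)

text \<open>\<open>Y\<close> can differ between \<open>s\<close> and \<open>t\<close> only if the
  clock does, which has probability \<open>1 - exp (- (t - s) * base.total_rate)\<close>.\<close>

lemma iter_prob_lipschitz:
  assumes s: "0 \<le> s" and "s \<le> t"
  shows "\<bar>iter_prob t a - iter_prob s a\<bar> \<le> base.total_rate * (t - s)"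
proof -
  have t: "0 \<le> t" using assms by simp
  note [measurable] = measurable_Y[OF s] measurable_Y[OF t]
    base.random_variable_X[OF s] base.random_variable_X[OF t]
  let ?D = "{\<omega> \<in> space P. M\<^sub>0 t \<omega> \<noteq> M\<^sub>0 s \<omega>}"
  let ?A = "{\<omega> \<in> space P. Y s \<omega> = a}" and ?B = "{\<omega> \<in> space P. Y t \<omega> = a}"
  have sets: "?A \<in> events" "?B \<in> events" "?D \<in> events"
    using s t measurable_compose_countable[of "\<lambda>i \<omega>. M\<^sub>0 t \<omega> \<noteq> i" P "count_space UNIV" "M\<^sub>0 s"]
    by (simp_all add: pred_def)
  have "prob ?A \<le> prob (?B \<union> ?D)" "prob ?B \<le> prob (?A \<union> ?D)"
    using sets by (intro finite_measure_mono; auto simp: iterated_process_def)+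
  moreover have "prob (?B \<union> ?D) \<le> prob ?B + prob ?D" "prob (?A \<union> ?D) \<le> prob ?A + prob ?D"
    using sets by (intro measure_Un_le; simp)+
  ultimately have "\<bar>iter_prob t a - iter_prob s a\<bar> \<le> prob ?D"
    unfolding iter_prob_def by linarith
  also have "prob ?D = 1 - base.state_prob (t - s) 0"
  proof -
    have "{\<omega> \<in> space P. M\<^sub>0 t \<omega> = M\<^sub>0 s \<omega>} = space P - ?D" by auto
    then show ?thesis
      using base.prob_increment[of s "t - s" 0] assms prob_compl[OF sets(3)] by simp
  qed
  also have "\<dots> \<le> base.total_rate * (t - s)"
    using assms exp_ge_add_one_self[of "- (t - s) * base.total_rate"]
    by (simp add: base.state_prob_stay algebra_simps)
  finally show ?thesis .
qed

text \<open>The intensity \<open>q\<^sub>m\<close> of jumps of \<open>Y\<close> by \<open>m\<close>: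
  the clock jumps by \<open>r\<close> at rate \<open>\<mu> r\<close>, and \<open>M\<close> then
  advances by \<open>m\<close> over \<open>r\<close> units of time.\<close>

definition jump_rate :: "nat \<Rightarrow> real" where
  "jump_rate m = (\<Sum>r=1..k\<^sub>0. \<mu> r * state_prob (real r) m)"

lemma mu_nonneg: "r \<in> {1..k\<^sub>0} \<Longrightarrow> 0 \<le> \<mu> r"
  using base.rate_pos by (simp add: less_imp_le)

lemma jump_rate_nonneg: "0 \<le> jump_rate m"
  unfolding jump_rate_def by (intro sum_nonneg mult_nonneg_nonneg mu_nonneg state_prob_nonneg)

lemma jump_rate_le: "jump_rate m \<le> base.total_rate"
  unfolding jump_rate_def base.total_rate_def
  by (intro sum_mono mult_left_le state_prob_le_1 mu_nonneg)

text \<open>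
  \<open>base.state_prob h r\<close> is at least \<open>h \<mu>\<^sub>r exp (- h \<mu>)\<close> for \<open>1 \<le> r \<le> k\<^sub>0\<close>, and by
  normalisation the total excess over these lower bounds is
  \<open>1 - exp (- h \<mu>) - h \<mu> exp (- h \<mu>)\<close>, which is of second order.
\<close>

lemma iter_prob_small_time:
  assumes h: "0 \<le> h" and m: "1 \<le> m"
  shows "\<bar>iter_prob h m - h * jump_rate m\<bar> \<le> (h * base.total_rate)\<^sup>2"
proof -
  define e where "e = exp (- h * base.total_rate)"
  define c where "c r = (if r \<in> {1..k\<^sub>0} then h * \<mu> r * e else 0)" for r
  \<comment> \<open>The index 0 carries mass of order one, but it drops out of
    \<open>iter_prob h m\<close> because \<open>state_prob 0 m = 0\<close> for
    \<open>m \<ge> 1\<close>.\<close>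
  define d where "d r = (if r = 0 then 0 else base.state_prob h r - c r)" for r
  have e: "0 \<le> e" "1 - h * base.total_rate \<le> e" "e \<le> 1"
    using exp_ge_add_one_self[of "- h * base.total_rate"] h base.total_rate_nonneg
    by (auto simp: e_def)
  have c_le: "c r \<le> base.state_prob h r" for r
  proof (cases "r \<in> {1..k\<^sub>0}")
    case True
    then have "h * \<mu> r * e \<le> gcp_weight k\<^sub>0 \<mu> h r * e"
      using h e mu_nonneg by (intro mult_right_mono gcp_weight_ge) auto
    then show ?thesis
      using True h by (simp add: c_def base.state_prob_eq e_def)
  qed (auto simp: c_def base.state_prob_nonneg)
  then have d_nonneg: "0 \<le> d r" for r by (simp add: d_def)
  have "c sums (\<Sum>r\<in>{1..k\<^sub>0}. c r)"
    by (rule sums_finite) (auto simp: c_def)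
  moreover have "(\<Sum>r\<in>{1..k\<^sub>0}. c r) = h * base.total_rate * e"
    by (simp add: c_def base.total_rate_def sum_distrib_left sum_distrib_right)
  ultimately have c_sums: "c sums (h * base.total_rate * e)" by simp
  have "(\<lambda>r. c r * state_prob (real r) m) sums (\<Sum>r\<in>{1..k\<^sub>0}. c r * state_prob (real r) m)"
    by (rule sums_finite) (auto simp: c_def)
  moreover have "(\<Sum>r\<in>{1..k\<^sub>0}. c r * state_prob (real r) m) = h * jump_rate m * e"
    by (simp add: c_def jump_rate_def sum_distrib_left sum_distrib_right algebra_simps)
  ultimately have cm_sums: "(\<lambda>r. c r * state_prob (real r) m) sums (h * jump_rate m * e)" by simp
  have "(\<lambda>r. base.state_prob h r - c r - (if r = 0 then e else 0)) sums (1 - h * base.total_rate * e - e)"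
    by (intro sums_diff base.state_prob_sums h c_sums sums_single[of 0 "\<lambda>_. e"])
  moreover have "(\<lambda>r. base.state_prob h r - c r - (if r = 0 then e else 0)) = d"
    using h by (auto simp: fun_eq_iff d_def c_def base.state_prob_stay e_def)
  ultimately have d_sums: "d sums (1 - h * base.total_rate * e - e)" by simp
  have "(\<lambda>r. base.state_prob h r * state_prob (real r) m - c r * state_prob (real r) m)
      sums (iter_prob h m - h * jump_rate m * e)"
    by (intro sums_diff iter_prob_sums h cm_sums)
  moreover have "base.state_prob h r * state_prob (real r) m - c r * state_prob (real r) m =
      d r * state_prob (real r) m" for r
    using m by (cases "r = 0") (auto simp: d_def state_prob_0 left_diff_distrib)
  ultimately have dm_sums: "(\<lambda>r. d r * state_prob (real r) m) sums (iter_prob h m - h * jump_rate m * e)"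
    by simp
  have "0 \<le> iter_prob h m - h * jump_rate m * e"
    by (rule sums_le[OF _ sums_zero dm_sums]) (simp add: d_nonneg state_prob_nonneg)
  moreover have "iter_prob h m - h * jump_rate m * e \<le> 1 - h * base.total_rate * e - e"
    by (rule sums_le[OF _ dm_sums d_sums]) (simp add: d_nonneg state_prob_le_1 mult_left_le)
  moreover have "1 - h * base.total_rate * e - e \<le> (h * base.total_rate)\<^sup>2"
  proof -
    \<comment> \<open>With \<open>x = h * base.total_rate\<close>, the bound
      \<open>1 - x \<le> e\<close> gives \<open>1 - x\<^sup>2 \<le> e * (1 + x)\<close>.\<close>
    have "(1 - h * base.total_rate) * (1 + h * base.total_rate) \<le> e * (1 + h * base.total_rate)"
      using e h base.total_rate_nonneg by (intro mult_right_mono) auto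
    then show ?thesis by (simp add: algebra_simps power2_eq_square)
  qed
  \<comment> \<open>This is the cost of dropping the factor \<open>e\<close> from the main term. It
    enters with the opposite sign to the excess above, so the two second-order errors do not add
    up.\<close>
  moreover have "h * jump_rate m * (1 - e) \<le> (h * base.total_rate) * (h * base.total_rate)"
    using e h jump_rate_le jump_rate_nonneg base.total_rate_nonneg
    by (intro mult_mono mult_nonneg_nonneg) auto
  moreover have "0 \<le> h * jump_rate m * (1 - e)"
    using e h jump_rate_nonneg by simp
  ultimately show ?thesis
    by (simp add: abs_le_iff algebra_simps power2_eq_square)
qed

end

section \<open>First passage on a grid\<close>

text \<open>On each cell \<open>g\<close> stays within \<open>L * h\<close> of its value at the left
  end, so every cell costs at most \<open>L * h\<^sup>2\<close>. With \<open>K * h\<close> bounded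
  the total is of order \<open>h\<close>.\<close>

lemma left_riemann_sum_error:
  fixes g :: "real \<Rightarrow> real"
  assumes L: "\<And>x y. 0 \<le> x \<Longrightarrow> x \<le> y \<Longrightarrow> \<bar>g y - g x\<bar> \<le> L * (y - x)"
    and g: "continuous_on {0..} g" and h: "0 \<le> h"
  shows "\<bar>(\<Sum>i<K. h * g (real i * h)) - integral {0..real K * h} g\<bar> \<le> real K * L * h\<^sup>2"
proof (induction K)
  case (Suc K)
  let ?a = "real K * h" and ?b = "real (Suc K) * h"
  have a: "0 \<le> ?a" and ab: "?a \<le> ?b"
    using h by (auto simp: mult_right_mono)
  have L0: "0 \<le> L"
    using L[of 0 1] by simp
  have int: "g integrable_on {x..y}" if "0 \<le> x" for x y
    using that by (intro integrable_continuous_interval continuous_on_subset[OF g]) auto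
  have "norm (integral {?a..?b} (\<lambda>x. g x - g ?a)) \<le> (L * h) * (?b - ?a)"
  proof (rule integral_bound[OF ab])
    show "continuous_on {?a..?b} (\<lambda>x. g x - g ?a)"
      using a by (intro continuous_intros continuous_on_subset[OF g]) auto
    fix x assume "x \<in> {?a..?b}"
    then have "\<bar>g x - g ?a\<bar> \<le> L * (x - ?a)"
      using a by (intro L) auto
    also have "\<dots> \<le> L * h"
      using \<open>x \<in> _\<close> L0 by (intro mult_left_mono) (auto simp: algebra_simps)
    finally show "norm (g x - g ?a) \<le> L * h" by simp
  qed
  moreover have "integral {?a..?b} (\<lambda>x. g x - g ?a) = integral {?a..?b} g - h * g ?a"
    using int[OF a, of ?b] ab by (subst integral_diff) (auto simp: algebra_simps)
  ultimately have "\<bar>integral {?a..?b} g - h * g ?a\<bar> \<le> L * h\<^sup>2"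
    by (simp add: algebra_simps power2_eq_square)
  moreover have "integral {0..?a} g + integral {?a..?b} g = integral {0..?b} g"
    using a ab int[of 0 ?b]
    by (intro Henstock_Kurzweil_Integration.integral_combine) auto
  ultimately show ?case
    using Suc by (simp add: algebra_simps)
qed simp

context independent_gcps
begin

text \<open>The density in probabilistic form: \<open>Y\<close> sits at \<open>n - m\<close> and
  jumps by \<open>m\<close>. Its agreement with the explicit formula is
  \<open>passage_rate_expansion\<close>.\<close>

definition passage_rate :: "nat \<Rightarrow> real \<Rightarrow> real" where
  "passage_rate n s = (\<Sum>m=1..n. iter_prob s (n - m) * jump_rate m)"

lemma passage_rate_nonneg: "0 \<le> passage_rate n s"
  unfolding passage_rate_def
  by (intro sum_nonneg mult_nonneg_nonneg iter_prob_nonneg jump_rate_nonneg)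

lemma passage_rate_lipschitz:
  assumes "0 \<le> x" "x \<le> y"
  shows "\<bar>passage_rate n y - passage_rate n x\<bar> \<le> real n * base.total_rate\<^sup>2 * (y - x)"
proof -
  have "\<bar>passage_rate n y - passage_rate n x\<bar> =
      \<bar>\<Sum>m=1..n. (iter_prob y (n - m) - iter_prob x (n - m)) * jump_rate m\<bar>"
    by (simp add: passage_rate_def sum_subtractf left_diff_distrib)
  also have "\<dots> \<le> (\<Sum>m=1..n. \<bar>(iter_prob y (n - m) - iter_prob x (n - m)) * jump_rate m\<bar>)"
    by (rule sum_abs)
  also have "\<dots> \<le> (\<Sum>m=1..n. (base.total_rate * (y - x)) * base.total_rate)"
    unfolding abs_mult using assms
    by (intro sum_mono mult_mono)
       (auto simp: iter_prob_lipschitz jump_rate_nonneg jump_rate_le base.total_rate_nonneg)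
  finally show ?thesis by (simp add: power2_eq_square algebra_simps)
qed

lemma passage_rate_continuous: "continuous_on {0..} (passage_rate n)"
proof -
  have "(real n * base.total_rate\<^sup>2)-lipschitz_on {0..} (passage_rate n)"
  proof (rule lipschitz_onI)
    fix x y :: real assume "x \<in> {0..}" "y \<in> {0..}"
    then show "dist (passage_rate n x) (passage_rate n y) \<le> real n * base.total_rate\<^sup>2 * dist x y"
      using passage_rate_lipschitz[of x y n] passage_rate_lipschitz[of y x n]
      by (cases "x \<le> y") (auto simp: dist_real_def abs_minus_commute)
  qed simp
  then show ?thesis by (rule lipschitz_on_continuous_on)
qed

text \<open>Induction on the number of steps. Along a path that is nondecreasing on the grid, a
  visit at step \<open>Suc K\<close> is the first one exactly when the state at step
  \<open>K\<close> is below \<open>n\<close>, so the new probability simply adds to the old.\<close>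

lemma prob_hit_grid:
  assumes h: "0 \<le> h" and n: "1 \<le> n"
  shows "\<P>(\<omega> in P. \<exists>i\<in>{1..K}. Y (real i * h) \<omega> = n) =
    (\<Sum>i<K. \<Sum>m=1..n. iter_prob (real i * h) (n - m) * iter_prob h m)"
proof (induction K)
  case (Suc K)
  define E where "E K = {\<omega> \<in> space P. \<exists>i\<in>{1..K}. Y (real i * h) \<omega> = n}" for K
  \<comment> \<open>Steps into \<open>n\<close> are split by jump size. The target is written
    \<open>(n - m) + m\<close> to fit \<open>iter_prob_two_states\<close>; truncation is harmless as
    \<open>m \<le> n\<close>.\<close>
  define J where "J m = {\<omega> \<in> space P. Y (real K * h) \<omega> = n - m \<and> Y (real K * h + h) \<omega> = (n - m) + m}" for m
  have times: "0 \<le> real i * h" for i using h by simp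
  note [measurable] = measurable_Y[OF times] measurable_Y[OF add_nonneg_nonneg[OF times h]]
  have E_sets [measurable]: "E K \<in> events" for K
    unfolding E_def by measurable
  have J_sets [measurable]: "J m \<in> events" for m
    unfolding J_def by measurable
  have next_time: "real (Suc i) * h = real i * h + h" for i
    by (simp add: distrib_right)
  have AE: "AE \<omega> in P. \<forall>i. Y (real i * h) \<omega> \<le> Y (real (Suc i) * h) \<omega>"
    unfolding AE_all_countable next_time using AE_Y_mono[OF times h] by blast
  have J_iff: "\<omega> \<in> (\<Union>m\<in>{1..n}. J m) \<longleftrightarrow>
      \<omega> \<in> space P \<and> Y (real K * h) \<omega> < n \<and> Y (real (Suc K) * h) \<omega> = n" for \<omega>
  proof -
    have "(\<exists>m\<in>{1..n}. a = n - m \<and> b = n - m + m) \<longleftrightarrow> a < n \<and> b = n" for a b :: nat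
      by (auto intro!: bexI[of _ "n - a"])
    moreover have "\<omega> \<in> (\<Union>m\<in>{1..n}. J m) \<longleftrightarrow> \<omega> \<in> space P \<and>
        (\<exists>m\<in>{1..n}. Y (real K * h) \<omega> = n - m \<and> Y (real (Suc K) * h) \<omega> = n - m + m)"
      unfolding J_def next_time by blast
    ultimately show ?thesis by (simp only:)
  qed
  have E_Suc: "\<omega> \<in> E (Suc K) \<longleftrightarrow> \<omega> \<in> E K \<or> \<omega> \<in> space P \<and> Y (real (Suc K) * h) \<omega> = n" for \<omega>
  proof -
    have "i \<in> {1..Suc K} \<longleftrightarrow> i \<in> {1..K} \<or> i = Suc K" for i by auto
    then show ?thesis unfolding E_def by blast
  qed
  have disj: "AE \<omega> in P. \<omega> \<notin> E K \<or> \<omega> \<notin> (\<Union>m\<in>{1..n}. J m)"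
    using AE
  proof eventually_elim
    case (elim \<omega>)
    have "Y (real i * h) \<omega> \<le> Y (real K * h) \<omega>" if "i \<le> K" for i
      by (rule lift_Suc_mono_le[of "\<lambda>i. Y (real i * h) \<omega>", OF _ that]) (rule elim[rule_format])
    then show ?case
      unfolding J_iff E_def by fastforce
  qed
  have "prob (E (Suc K)) = prob (E K \<union> (\<Union>m\<in>{1..n}. J m))"
  proof (rule measure_eq_AE)
    show "AE \<omega> in P. \<omega> \<in> E (Suc K) \<longleftrightarrow> \<omega> \<in> E K \<union> (\<Union>m\<in>{1..n}. J m)"
      using AE AE_space
    proof eventually_elim
      case (elim \<omega>)
      have "Y (real K * h) \<omega> < n" if "\<omega> \<notin> E K" "Y (real (Suc K) * h) \<omega> = n"
      proof -
        \<comment> \<open>For \<open>K = 0\<close> the event \<open>E K\<close> is empty and gives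
          no information; there \<open>Y 0 = 0\<close> and \<open>n \<ge> 1\<close> decide.\<close>
        have "Y (real K * h) \<omega> \<noteq> n"
          using that(1) n elim(2) Y_0[of \<omega>] by (cases "K = 0") (auto simp: E_def)
        moreover have "Y (real K * h) \<omega> \<le> n"
          using elim(1)[rule_format, of K] that(2) by (simp only:)
        ultimately show ?thesis by simp
      qed
      then show ?case
        using elim(2) unfolding Un_iff J_iff E_Suc by blast
    qed
  qed auto
  also have "prob (E K \<union> (\<Union>m\<in>{1..n}. J m)) = prob (E K) + prob (\<Union>m\<in>{1..n}. J m)"
    by (rule measure_Un_AE[OF disj]) (auto simp: fmeasurable_eq_sets)
  also have "prob (\<Union>m\<in>{1..n}. J m) = (\<Sum>m\<in>{1..n}. prob (J m))"
    by (rule finite_measure_finite_Union) (auto simp: disjoint_family_on_def J_def)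
  also have "(\<Sum>m\<in>{1..n}. prob (J m)) = (\<Sum>m\<in>{1..n}. iter_prob (real K * h) (n - m) * iter_prob h m)"
    unfolding J_def by (simp only: iter_prob_two_states[OF times h])
  finally show ?case
    using Suc by (simp add: E_def)
qed simp

text \<open>Convergence in a discrete space is eventual equality, so the clock is constant just
  after \<open>t\<close>, and \<open>Y\<close> depends on time only through the clock.\<close>

lemma locally_constant_right:
  assumes \<omega>: "\<omega> \<in> space P" and t: "0 \<le> t"
  obtains u where "t < u" "\<And>s. t \<le> s \<Longrightarrow> s < u \<Longrightarrow> Y s \<omega> = Y t \<omega>"
proof -
  have "((\<lambda>s. M\<^sub>0 s \<omega>) \<longlongrightarrow> M\<^sub>0 t \<omega>) (at_right t)"
    using base.right_continuous[OF \<omega> t] by (simp add: continuous_within)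
  then have "eventually (\<lambda>s. M\<^sub>0 s \<omega> = M\<^sub>0 t \<omega>) (at_right t)"
    by (simp add: tendsto_discrete)
  then obtain u where "t < u" "\<And>s. t < s \<Longrightarrow> s < u \<Longrightarrow> M\<^sub>0 s \<omega> = M\<^sub>0 t \<omega>"
    unfolding eventually_at_right_field by auto
  then show thesis
    by (intro that[of u]) (auto simp: iterated_process_def le_less)
qed

section \<open>The first-passage time as a limit over dyadic grids\<close>

abbreviation T :: "nat \<Rightarrow> 'a \<Rightarrow> ereal" where
  "T n \<equiv> first_passage_time Y n"

lemma T_less_iff: "T n \<omega> < ereal t \<longleftrightarrow> (\<exists>s. 0 < s \<and> s < t \<and> Y s \<omega> = n)"
  by (auto simp: first_passage_time_def Inf_less_iff)

text \<open>\<open>Y\<close> rests at 0 during an initial interval. Hence \<open>T n < b\<close> and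
  \<open>0 < T n < b\<close> are the same event.\<close>

lemma T_pos:
  assumes "\<omega> \<in> space P" "1 \<le> n"
  shows "0 < T n \<omega>"
proof -
  obtain u where u: "0 < u" "\<And>s. 0 \<le> s \<Longrightarrow> s < u \<Longrightarrow> Y s \<omega> = Y 0 \<omega>"
    using locally_constant_right[OF assms(1), of 0] by auto
  then have "\<not> T n \<omega> < ereal u"
    using assms Y_0[of \<omega>] by (auto simp: T_less_iff)
  moreover have "0 < ereal u" using u by simp
  ultimately show ?thesis by (meson less_le_trans not_less)
qed

text \<open>The grid points lie strictly between 0 and \<open>t\<close>, matching the strict event
  \<open>T n < t\<close>. Halving the mesh keeps the old points, so the events increase with
  \<open>N\<close>.\<close>

definition hit_grid :: "nat \<Rightarrow> real \<Rightarrow> nat \<Rightarrow> 'a set" where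
  "hit_grid n t N = {\<omega> \<in> space P. \<exists>i\<in>{1..2 ^ N - 1}. Y (real i * (t / 2 ^ N)) \<omega> = n}"

lemma hit_grid_sets [measurable]: "0 \<le> t \<Longrightarrow> hit_grid n t N \<in> events"
  unfolding hit_grid_def by measurable

lemma hit_grid_incseq: "incseq (hit_grid n t)"
proof (rule incseq_SucI, rule subsetI)
  fix N \<omega> assume "\<omega> \<in> hit_grid n t N"
  then obtain i where i: "1 \<le> i" "i \<le> 2 ^ N - 1" "Y (real i * (t / 2 ^ N)) \<omega> = n" "\<omega> \<in> space P"
    by (auto simp: hit_grid_def)
  have "i < 2 ^ N"
    using i(2) by (metis One_nat_def Suc_pred less_Suc_eq_le pos2 zero_less_power)
  then have "2 * i \<in> {1..2 ^ Suc N - 1}"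
    using i by auto
  moreover have "real (2 * i) * (t / 2 ^ Suc N) = real i * (t / 2 ^ N)"
    by simp
  ultimately show "\<omega> \<in> hit_grid n t (Suc N)"
    using i unfolding hit_grid_def by (auto intro!: bexI[of _ "2 * i"])
qed

text \<open>A visit to \<open>n\<close> at time \<open>s\<close> lasts for a while after
  \<open>s\<close>, so any grid finer than that duration, cut off at \<open>t\<close>, has a point
  inside it.\<close>

lemma T_less_eq_hit_grid:
  assumes t: "0 < t"
  shows "{\<omega> \<in> space P. T n \<omega> < ereal t} = (\<Union>N. hit_grid n t N)"
proof (intro equalityI subsetI)
  fix \<omega> assume "\<omega> \<in> {\<omega> \<in> space P. T n \<omega> < ereal t}"
  then obtain s where s: "0 < s" "s < t" "Y s \<omega> = n" and \<omega>: "\<omega> \<in> space P"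
    by (auto simp: T_less_iff)
  obtain u where u: "s < u" "\<And>r. s \<le> r \<Longrightarrow> r < u \<Longrightarrow> Y r \<omega> = n"
    using locally_constant_right[OF \<omega>, of s] s by auto
  define v where "v = min u t"
  have "s < v" using u s by (simp add: v_def)
  obtain N where N: "t / (v - s) < 2 ^ N"
    using real_arch_pow[of 2 "t / (v - s)"] by auto
  define h where "h = t / 2 ^ N"
  have h: "0 < h" "h < v - s"
    using N t \<open>s < v\<close> by (simp_all add: h_def field_simps)
  \<comment> \<open>The index of the first grid point at or after \<open>s\<close>.\<close>
  define i where "i = nat \<lceil>s / h\<rceil>"
  have "0 < s / h" using s h by simp
  then have i: "1 \<le> i" "s / h \<le> real i" "real i < s / h + 1"
    unfolding i_def by linarith+
  have "s \<le> real i * h" "real i * h < s + h"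
    using i h by (simp_all add: field_simps)
  then have ih: "s \<le> real i * h" "real i * h < u" "real i * h < t"
    using h by (auto simp: v_def)
  then have "real i < 2 ^ N"
    using t by (simp add: h_def field_simps)
  then have "i < 2 ^ N"
    by (metis of_nat_less_iff of_nat_numeral of_nat_power)
  then have "\<omega> \<in> hit_grid n t N"
    unfolding hit_grid_def using \<omega> i(1) u(2)[of "real i * h"] ih
    by (auto simp: h_def intro!: bexI[of _ i])
  then show "\<omega> \<in> (\<Union>N. hit_grid n t N)" by blast
next
  fix \<omega> assume "\<omega> \<in> (\<Union>N. hit_grid n t N)"
  then obtain N i where i: "1 \<le> i" "i \<le> 2 ^ N - 1" "Y (real i * (t / 2 ^ N)) \<omega> = n" "\<omega> \<in> space P"
    by (auto simp: hit_grid_def)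
  have "i < 2 ^ N"
    using i(2) by (metis One_nat_def Suc_pred less_Suc_eq_le pos2 zero_less_power)
  then have "real i < 2 ^ N"
    by (metis of_nat_less_iff of_nat_numeral of_nat_power)
  then have "real i * (t / 2 ^ N) < t"
    using t by (simp add: field_simps)
  moreover have "0 < real i * (t / 2 ^ N)"
    using i t by simp
  ultimately show "\<omega> \<in> {\<omega> \<in> space P. T n \<omega> < ereal t}"
    using i by (auto simp: T_less_iff)
qed

text \<open>The probabilities of \<open>hit_grid n t N\<close> have two limits that must agree: one
  by continuity from below, the other by the Riemann sum estimate.\<close>

lemma prob_T_less:
  assumes t: "0 < t" and n: "1 \<le> n"
  shows "\<P>(\<omega> in P. T n \<omega> < ereal t) = integral {0..t} (passage_rate n)"
proof (rule LIMSEQ_unique)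
  define h where "h N = t / 2 ^ N" for N :: nat
  define K where "K N = (2::nat) ^ N - 1" for N :: nat
  \<comment> \<open>This number serves twice: as the Lipschitz constant of
    \<open>passage_rate n\<close>, and as the factor in the error from linearising the
    \<open>n\<close> one-step probabilities.\<close>
  define L where "L = real n * base.total_rate\<^sup>2"
  have h: "0 \<le> h N" for N using t by (simp add: h_def)
  have "real (K N) = 2 ^ N - 1" for N
    by (simp add: K_def of_nat_diff)
  then have Kh: "real (K N) * h N = t - h N" for N
    by (simp add: h_def left_diff_distrib diff_divide_distrib)
  have h_lim: "h \<longlonglongrightarrow> 0"
    unfolding h_def by (rule LIMSEQ_divide_realpow_zero) simp
  have "(\<lambda>N. prob (hit_grid n t N)) \<longlonglongrightarrow> prob (\<Union>N. hit_grid n t N)"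
    using t by (intro finite_Lim_measure_incseq hit_grid_incseq) auto
  then show "(\<lambda>N. prob (hit_grid n t N)) \<longlonglongrightarrow> \<P>(\<omega> in P. T n \<omega> < ereal t)"
    by (simp add: T_less_eq_hit_grid[OF t])
  \<comment> \<open>Two errors, each at most \<open>t * L * h N\<close>: replacing
    \<open>iter_prob (h N) m\<close> by \<open>h N * jump_rate m\<close>, and replacing the Riemann
    sum by the integral. The \<open>2 ^ N - 1\<close> steps end at \<open>t - h N\<close>; the
    missing last cell vanishes in the limit by continuity of the integral.\<close>
  have bound: "\<bar>prob (hit_grid n t N) - integral {0..t - h N} (passage_rate n)\<bar> \<le> 2 * t * L * h N" for N
  proof -
    have "prob (hit_grid n t N) =
        (\<Sum>i<K N. \<Sum>m=1..n. iter_prob (real i * h N) (n - m) * iter_prob (h N) m)"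
      unfolding hit_grid_def h_def[symmetric] K_def[symmetric] by (rule prob_hit_grid[OF h n])
    moreover have "(\<Sum>i<K N. h N * passage_rate n (real i * h N)) =
        (\<Sum>i<K N. \<Sum>m=1..n. iter_prob (real i * h N) (n - m) * (h N * jump_rate m))"
      by (simp add: passage_rate_def sum_distrib_left algebra_simps)
    ultimately have "\<bar>prob (hit_grid n t N) - (\<Sum>i<K N. h N * passage_rate n (real i * h N))\<bar> =
        \<bar>\<Sum>i<K N. \<Sum>m=1..n. iter_prob (real i * h N) (n - m) * (iter_prob (h N) m - h N * jump_rate m)\<bar>"
      by (simp add: sum_subtractf right_diff_distrib)
    also have "\<dots> \<le> (\<Sum>i<K N. \<Sum>m=1..n. 1 * (h N * base.total_rate)\<^sup>2)"
    proof (intro order_trans[OF sum_abs] sum_mono)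
      fix i m assume "m \<in> {1..n}"
      then show "\<bar>iter_prob (real i * h N) (n - m) * (iter_prob (h N) m - h N * jump_rate m)\<bar>
          \<le> 1 * (h N * base.total_rate)\<^sup>2"
        unfolding abs_mult using h
        by (intro mult_mono iter_prob_small_time) (auto simp: iter_prob_nonneg iter_prob_le_1)
    qed
    also have "\<dots> = (real (K N) * h N) * L * h N"
      by (simp add: L_def power2_eq_square algebra_simps)
    finally have "\<bar>prob (hit_grid n t N) - (\<Sum>i<K N. h N * passage_rate n (real i * h N))\<bar>
        \<le> (t - h N) * L * h N" by (simp add: Kh)
    moreover have "\<bar>(\<Sum>i<K N. h N * passage_rate n (real i * h N)) -
        integral {0..real (K N) * h N} (passage_rate n)\<bar> \<le> real (K N) * L * (h N)\<^sup>2"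
      unfolding L_def by (intro left_riemann_sum_error passage_rate_lipschitz passage_rate_continuous h)
    moreover have "real (K N) * L * (h N)\<^sup>2 = (t - h N) * L * h N"
      by (simp add: Kh[symmetric] power2_eq_square)
    moreover have "(t - h N) * L * h N \<le> t * L * h N"
      using h[of N] by (intro mult_right_mono) (auto simp: L_def)
    ultimately show ?thesis
      unfolding Kh by linarith
  qed
  have "(\<lambda>N. prob (hit_grid n t N) - integral {0..t - h N} (passage_rate n)) \<longlonglongrightarrow> 0"
  proof (rule Lim_null_comparison)
    show "eventually (\<lambda>N. norm (prob (hit_grid n t N) - integral {0..t - h N} (passage_rate n))
        \<le> 2 * t * L * h N) sequentially"
      using bound by simp
    show "(\<lambda>N. 2 * t * L * h N) \<longlonglongrightarrow> 0"
      by (rule tendsto_mult_right_zero[OF h_lim])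
  qed
  moreover have "(\<lambda>N. integral {0..t - h N} (passage_rate n)) \<longlonglongrightarrow> integral {0..t} (passage_rate n)"
  proof (rule continuous_on_tendsto_compose[where s = "{0..t}" and f = "\<lambda>x. integral {0..x} (passage_rate n)"])
    show "continuous_on {0..t} (\<lambda>x. integral {0..x} (passage_rate n))"
      by (intro indefinite_integral_continuous_1 integrable_continuous_interval
          continuous_on_subset[OF passage_rate_continuous]) auto
    show "(\<lambda>N. t - h N) \<longlonglongrightarrow> t"
      using tendsto_diff[OF tendsto_const h_lim, of t] by simp
    have "h N \<le> t" for N
      using t by (simp add: h_def field_simps)
    then show "eventually (\<lambda>N. t - h N \<in> {0..t}) sequentially"
      using h by simp
  qed (use t in simp)
  ultimately show "(\<lambda>N. prob (hit_grid n t N)) \<longlonglongrightarrow> integral {0..t} (passage_rate n)"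
    using tendsto_add by fastforce
qed

section \<open>The density of the first-passage time\<close>

text \<open>Strict sublevel sets suffice: they are empty at levels up to 0, unions of grid events at
  finite positive levels, and a countable union of these at infinity.\<close>

lemma measurable_T [measurable]:
  assumes n: "1 \<le> n"
  shows "T n \<in> borel_measurable P"
proof (rule borel_measurableI_less)
  have pos: "{\<omega> \<in> space P. T n \<omega> < ereal t} \<in> events" if "0 < t" for t
    using that by (simp add: T_less_eq_hit_grid)
  fix y :: ereal
  consider "y \<le> 0" | t where "y = ereal t" "0 < t" | "y = \<infinity>"
    by (cases y) (auto simp: not_le[symmetric])
  then show "{\<omega> \<in> space P. T n \<omega> < y} \<in> events"
  proof cases
    case 1
    have "{\<omega> \<in> space P. T n \<omega> < y} = {}"
      by (auto simp: not_less intro!: less_imp_le le_less_trans[OF 1] T_pos n)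
    then show ?thesis by (simp only: sets.empty_sets)
  next
    case 2
    then show ?thesis using pos by simp
  next
    case 3
    have "T n \<omega> < y \<longleftrightarrow> (\<exists>i::nat. T n \<omega> < ereal (real (Suc i)))" for \<omega>
    proof
      assume "T n \<omega> < y"
      then obtain r where "T n \<omega> < ereal r"
        using 3 less_PInf_Ex_of_nat by auto
      moreover obtain i :: nat where "r < real i"
        using reals_Archimedean2 by blast
      then have "ereal r \<le> ereal (real (Suc i))" by simp
      ultimately show "\<exists>i::nat. T n \<omega> < ereal (real (Suc i))"
        using less_le_trans by blast
    qed (use 3 in auto)
    then have "{\<omega> \<in> space P. T n \<omega> < y} = (\<Union>i. {\<omega> \<in> space P. T n \<omega> < ereal (real (Suc i))})"
      by auto
    also have "\<dots> \<in> events"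
      by (intro sets.countable_UN image_subsetI pos) simp
    finally show ?thesis .
  qed
qed

lemma nn_integral_passage_rate:
  "(\<integral>\<^sup>+s. ennreal (passage_rate n s) * indicator {0<..<t} s \<partial>lborel) =
    ennreal (integral {0..t} (passage_rate n))"
proof -
  have meas: "(\<lambda>s. indicator {0<..<t} s *\<^sub>R passage_rate n s) \<in> borel_measurable borel"
    by (intro borel_measurable_continuous_on_indicator continuous_on_subset[OF passage_rate_continuous]) auto
  have "(passage_rate n has_integral integral {0..t} (passage_rate n)) {0..t}"
    by (intro integrable_integral integrable_continuous_interval
        continuous_on_subset[OF passage_rate_continuous]) auto
  then have "(passage_rate n has_integral integral {0..t} (passage_rate n)) {0<..<t}"
    by (simp add: has_integral_Icc_iff_Ioo)
  then have "((\<lambda>s. indicator {0<..<t} s *\<^sub>R passage_rate n s) has_integral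
      integral {0..t} (passage_rate n)) UNIV"
    by (subst (asm) has_integral_restrict_UNIV[symmetric])
       (auto simp: indicator_def elim!: has_integral_eq_rhs intro: has_integral_eq[rotated])
  then have "(\<integral>\<^sup>+s. ennreal (indicator {0<..<t} s *\<^sub>R passage_rate n s) \<partial>lborel) =
      ennreal (integral {0..t} (passage_rate n))"
    by (intro nn_integral_has_integral_lborel meas) (auto simp: passage_rate_nonneg)
  moreover have "ennreal (indicator {0<..<t} s *\<^sub>R passage_rate n s) =
      ennreal (passage_rate n s) * indicator {0<..<t} s" for s
    by (simp add: indicator_def)
  ultimately show ?thesis by simp
qed

lemma passage_rate_measurable:
  "(\<lambda>s. ennreal (passage_rate n s) * indicator {0<..} s) \<in> borel_measurable borel"
proof -
  have "(\<lambda>s. indicator {0<..} s *\<^sub>R passage_rate n s) \<in> borel_measurable borel"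
    by (intro borel_measurable_continuous_on_indicator continuous_on_subset[OF passage_rate_continuous]) auto
  then have "(\<lambda>s. ennreal (indicator {0<..} s *\<^sub>R passage_rate n s)) \<in> borel_measurable borel"
    by simp
  then show ?thesis
    by (rule measurable_cong[THEN iffD1, rotated]) (simp add: indicator_def)
qed

text \<open>Two measures on the reals are compared: the finite positive part of the law of
  \<open>T n\<close>, and the measure with density \<open>passage_rate n\<close>. They agree and are
  finite on the half-lines \<open>{..<b}\<close>, an intersection-stable generator of the Borel
  sets.\<close>

lemma first_passage_law:
  assumes n: "1 \<le> n" and A: "A \<in> sets borel" "A \<subseteq> {0<..}"
  shows "emeasure (distr P borel (T n)) (ereal ` A) =
    (\<integral>\<^sup>+s. ennreal (passage_rate n s) * indicator A s \<partial>lborel)"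
proof -
  note [measurable] = measurable_T[OF n] passage_rate_measurable
  define D where "D = distr P borel (T n)"
  \<comment> \<open>Restricting before applying \<open>real_of_ereal\<close> matters, since that map
    sends infinity to 0.\<close>
  define N1 where "N1 = distr (restrict_space D {0<..<\<infinity>}) borel real_of_ereal"
  define N2 where "N2 = density lborel (\<lambda>s. ennreal (passage_rate n s) * indicator {0<..} s)"
  have real_meas: "real_of_ereal \<in> restrict_space D {0<..<\<infinity>} \<rightarrow>\<^sub>M borel"
    by (intro measurable_restrict_space1) (simp add: D_def)
  have vimage: "real_of_ereal -` B \<inter> space (restrict_space D {0<..<\<infinity>}) = ereal ` (B \<inter> {0<..})" for B
  proof -
    have "x \<in> ereal ` (B \<inter> {0<..})" if "0 < x" "x < \<infinity>" "real_of_ereal x \<in> B" for x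
      using that by (cases x) auto
    then show ?thesis
      by (auto simp: space_restrict_space D_def)
  qed
  have N1: "emeasure N1 B = emeasure D (ereal ` (B \<inter> {0<..}))" if "B \<in> sets borel" for B
    unfolding N1_def using that
    by (subst emeasure_distr[OF real_meas], simp, subst vimage, subst emeasure_restrict_space)
       (auto simp: D_def)
  have N2: "emeasure N2 B = (\<integral>\<^sup>+s. ennreal (passage_rate n s) * indicator (B \<inter> {0<..}) s \<partial>lborel)"
    if "B \<in> sets borel" for B
    unfolding N2_def using that passage_rate_measurable
    by (subst emeasure_density) (auto intro!: nn_integral_cong simp: indicator_inter_arith mult_ac)
  have eq: "emeasure N1 {..<b} = emeasure N2 {..<b}" and fin: "emeasure N1 {..<b} \<noteq> \<infinity>" for b :: real
  proof -
    have Int: "{..<b} \<inter> {0<..} = {0<..<b}" by auto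
    have image: "ereal ` {0<..<b} = {0<..<ereal b}"
    proof (rule set_eqI)
      fix x show "x \<in> ereal ` {0<..<b} \<longleftrightarrow> x \<in> {0<..<ereal b}"
        by (cases x) (auto simp: image_iff)
    qed
    have "emeasure N1 {..<b} = emeasure P (T n -` {0<..<ereal b} \<inter> space P)"
      by (simp add: N1 Int image D_def emeasure_distr)
    also have "T n -` {0<..<ereal b} \<inter> space P = {\<omega> \<in> space P. T n \<omega> < ereal b}"
      using T_pos[OF _ n] by auto
    also have "emeasure P {\<omega> \<in> space P. T n \<omega> < ereal b} = ennreal (integral {0..b} (passage_rate n))"
    proof (cases "0 < b")
      case True
      then show ?thesis
        using prob_T_less[OF True n] by (simp add: emeasure_eq_measure)
    next
      \<comment> \<open>For \<open>b \<le> 0\<close> the event is empty, and \<open>{0..b}\<close>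
        is empty or a single point.\<close>
      case False
      then have empty: "{\<omega> \<in> space P. T n \<omega> < ereal b} = {}" by (auto simp: T_less_iff)
      show ?thesis unfolding empty using False by (cases "b = 0") auto
    qed
    finally have *: "emeasure N1 {..<b} = ennreal (integral {0..b} (passage_rate n))" .
    then show "emeasure N1 {..<b} \<noteq> \<infinity>" by simp
    show "emeasure N1 {..<b} = emeasure N2 {..<b}"
      by (simp add: * N2 Int nn_integral_passage_rate)
  qed
  have "N1 = N2"
  proof (rule measure_eqI_generator_eq)
    show "Int_stable (range (lessThan :: real \<Rightarrow> real set))"
    proof (clarsimp simp: Int_stable_def)
      fix a b :: real
      have "{..<a} \<inter> {..<b} = {..<min a b}" by auto
      then show "{..<a} \<inter> {..<b} \<in> range lessThan" by blast
    qed
    show "range (\<lambda>i::nat. {..<real i}) \<subseteq> range lessThan" by auto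
    show "(\<Union>i::nat. {..<real i}) = UNIV"
      using reals_Archimedean2 by auto
    have "sets borel = sigma_sets UNIV (range (lessThan :: real \<Rightarrow> real set))"
      by (simp add: borel_Iio)
    then show "sets N1 = sigma_sets UNIV (range lessThan)" "sets N2 = sigma_sets UNIV (range lessThan)"
      by (simp_all add: N1_def N2_def)
  qed (use eq fin in auto)
  then show ?thesis
    using N1[OF A(1)] N2[OF A(1)] A(2) by (simp add: D_def Int_absorb2)
qed

text \<open>The formula keeps \<open>exp (- s * \<mu>)\<close>, with \<open>\<mu>\<close> the total
  clock rate, in front of all sums. The innermost factor is therefore
  \<open>base.state_prob s r\<close> divided by that exponential, and the series over
  \<open>r\<close> then yields \<open>iter_prob s (n - m)\<close>.\<close>

lemma passage_rate_expansion:
  assumes s: "0 < s"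
  shows "(\<Sum>j\<^sub>0=1..k\<^sub>0. ennreal (\<mu> j\<^sub>0 * exp (- s * (\<Sum>i=1..k\<^sub>0. \<mu> i))) *
       (\<Sum>m=1..n. \<Sum>r. ennreal (
          (\<Sum>x\<in>Omega k (n - m). (\<Prod>j=1..k. (real r * l j) ^ x j / fact (x j))
             * exp (- real r * (\<Sum>j=1..k. l j)))
          * (\<Sum>z\<in>Omega k m. (\<Prod>j=1..k. (real j\<^sub>0 * l j) ^ z j / fact (z j))
             * exp (- real j\<^sub>0 * (\<Sum>j=1..k. l j)))
          * (\<Sum>y\<in>Omega k\<^sub>0 r. \<Prod>i=1..k\<^sub>0. (s * \<mu> i) ^ y i / fact (y i))))) =
    ennreal (passage_rate n s)"
proof -
  define e where "e = exp (- s * base.total_rate)"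
  have e: "0 < e" by (simp add: e_def)
  have law: "(\<Sum>x\<in>Omega k a. (\<Prod>j=1..k. (real r * l j) ^ x j / fact (x j))
      * exp (- real r * (\<Sum>j=1..k. l j))) = state_prob (real r) a" for r a
    by (simp add: state_prob_eq gcp_weight_def total_rate_def sum_distrib_right)
  have base_law: "(\<Sum>y\<in>Omega k\<^sub>0 r. \<Prod>i=1..k\<^sub>0. (s * \<mu> i) ^ y i / fact (y i)) =
      base.state_prob s r / e" for r
    using s by (simp add: base.state_prob_eq gcp_weight_def e_def)
  have inner: "(\<Sum>r. ennreal (state_prob (real r) (n - m) * state_prob (real j) m * (base.state_prob s r / e))) =
      ennreal (iter_prob s (n - m) * state_prob (real j) m / e)" for j m
  proof (rule suminf_ennreal_eq)
    show "(\<lambda>r. state_prob (real r) (n - m) * state_prob (real j) m * (base.state_prob s r / e)) sums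
        (iter_prob s (n - m) * state_prob (real j) m / e)"
      using sums_mult2[OF iter_prob_sums[of s "n - m"], of "state_prob (real j) m / e"] s
      by (simp add: mult_ac)
  qed (use e in \<open>simp add: state_prob_nonneg base.state_prob_nonneg\<close>)
  have "ennreal (\<mu> j * e) * (\<Sum>m=1..n. ennreal (iter_prob s (n - m) * state_prob (real j) m / e)) =
      ennreal (\<Sum>m=1..n. iter_prob s (n - m) * (\<mu> j * state_prob (real j) m))" if j: "j \<in> {1..k\<^sub>0}" for j
  proof -
    have "ennreal (\<mu> j * e) * (\<Sum>m=1..n. ennreal (iter_prob s (n - m) * state_prob (real j) m / e)) =
        ennreal ((\<mu> j * e) * (\<Sum>m=1..n. iter_prob s (n - m) * state_prob (real j) m / e))"
      using e mu_nonneg[OF j]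
      by (subst sum_ennreal) (auto simp: state_prob_nonneg iter_prob_nonneg ennreal_mult sum_nonneg)
    also have "(\<mu> j * e) * (\<Sum>m=1..n. iter_prob s (n - m) * state_prob (real j) m / e) =
        (\<Sum>m=1..n. iter_prob s (n - m) * (\<mu> j * state_prob (real j) m))"
      using e by (simp add: sum_distrib_left mult_ac)
    finally show ?thesis .
  qed
  then have "(\<Sum>j=1..k\<^sub>0. ennreal (\<mu> j * e) *
        (\<Sum>m=1..n. ennreal (iter_prob s (n - m) * state_prob (real j) m / e))) =
      (\<Sum>j=1..k\<^sub>0. ennreal (\<Sum>m=1..n. iter_prob s (n - m) * (\<mu> j * state_prob (real j) m)))"
    by (rule sum.cong[OF refl])
  also have "\<dots> = ennreal (\<Sum>j=1..k\<^sub>0. \<Sum>m=1..n. iter_prob s (n - m) * (\<mu> j * state_prob (real j) m))"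
    by (intro sum_ennreal sum_nonneg mult_nonneg_nonneg iter_prob_nonneg state_prob_nonneg mu_nonneg)
  also have "(\<Sum>j=1..k\<^sub>0. \<Sum>m=1..n. iter_prob s (n - m) * (\<mu> j * state_prob (real j) m)) = passage_rate n s"
    by (subst sum.swap) (simp add: passage_rate_def jump_rate_def sum_distrib_left)
  finally show ?thesis
    unfolding law base_law inner unfolding e_def base.total_rate_def .
qed

end

theorem theorem3p2:
  fixes P :: "'a measure"
    and M\<^sub>0 M :: "real \<Rightarrow> 'a \<Rightarrow> nat"
    and k\<^sub>0 k n :: nat
    and \<mu> l :: "nat \<Rightarrow> real"
  assumes "generalized_counting_process P k\<^sub>0 \<mu> M\<^sub>0"
    and "generalized_counting_process P k l M"
    and "independent_processes P M\<^sub>0 M"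
    and "1 \<le> n"
  shows "has_density_on_pos P (first_passage_time (iterated_process M M\<^sub>0) n)
    (\<lambda>s. \<Sum>j\<^sub>0=1..k\<^sub>0. ennreal (\<mu> j\<^sub>0 * exp (- s * (\<Sum>i=1..k\<^sub>0. \<mu> i))) *
       (\<Sum>m=1..n. \<Sum>r. ennreal (
          (\<Sum>x\<in>Omega k (n - m). (\<Prod>j=1..k. (real r * l j) ^ x j / fact (x j))
             * exp (- real r * (\<Sum>j=1..k. l j)))
          * (\<Sum>z\<in>Omega k m. (\<Prod>j=1..k. (real j\<^sub>0 * l j) ^ z j / fact (z j))
             * exp (- real j\<^sub>0 * (\<Sum>j=1..k. l j)))
          * (\<Sum>y\<in>Omega k\<^sub>0 r. \<Prod>i=1..k\<^sub>0. (s * \<mu> i) ^ y i / fact (y i)))))"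
    (is "has_density_on_pos P ?T ?f")
proof -
  interpret independent_gcps P k l M k\<^sub>0 \<mu> M\<^sub>0
    by (rule independent_gcps.intro) (simp_all add: assms independent_gcps_axioms_def)
  \<comment> \<open>The explicit formula is identified with \<open>passage_rate n\<close> only for
    positive times, which is all that the restricted measurability and the sets \<open>A\<close>
    see.\<close>
  have f: "?f s = ennreal (passage_rate n s)" if "0 < s" for s
    using passage_rate_expansion[OF that] .
  show ?thesis
    unfolding has_density_on_pos_def
  proof (intro conjI ballI impI)
    show "?T \<in> borel_measurable P"
      using \<open>1 \<le> n\<close> by (rule measurable_T)
    have "(\<lambda>s. ennreal (passage_rate n s) * indicator {0<..} s) \<in> borel_measurable (restrict_space lborel {0<..})"
      by (intro measurable_restrict_space1) (simp add: passage_rate_measurable)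
    then show "?f \<in> borel_measurable (restrict_space lborel {0<..})"
    proof (rule measurable_cong[THEN iffD1, rotated])
      fix s :: real assume "s \<in> space (restrict_space lborel {0<..})"
      then have "0 < s" by (simp add: space_restrict_space)
      then show "ennreal (passage_rate n s) * indicator {0<..} s = ?f s"
        unfolding f[OF \<open>0 < s\<close>] by simp
    qed
  next
    fix A :: "real set" assume A: "A \<in> sets borel" "A \<subseteq> {0<..}"
    have "?f s * indicator A s = ennreal (passage_rate n s) * indicator A s" for s
      using A(2) f[of s] by (cases "s \<in> A") auto
    then show "emeasure (distr P borel ?T) (ereal ` A) = (\<integral>\<^sup>+s\<in>A. ?f s \<partial>lborel)"
      using first_passage_law[OF \<open>1 \<le> n\<close> A] by simp
  qed
qed

end
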